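(* Let $\mu\in(0,1)$ and let $X$ be a random variable with the Borel distribution with parameter $\mu$, i.e. $\mathbb{P}(X=n)=e^{-\mu n}\frac{(\mu n)^{n-1}}{n!}$ for all integers $n\ge 1$. Let $(\kappa_X^{(n)})_{n\ge 1}$ be the cumulants of $X$. Then $\kappa_X^{(1)}=\frac{1}{1-\mu}$ and, for every $n\ge 2$, $$\kappa_X^{(n)}=\frac{\mu}{1-\mu}\Big(B_n\big(\kappa_X^{(1)},\ldots,\kappa_X^{(n)}\big)-\kappa_X^{(n)}\Big)=\frac{\mu}{1-\mu}\sum_{k=2}^n B_{n,k}\big(\kappa_X^{(1)},\ldots,\kappa_X^{(n-k+1)}\big).$$
   Context: The cumulants $(\kappa_X^{(n)})_{n\ge1}$ of a random variable $X$ are the coefficients in the expansion $\log\mathbb{E}[e^{tX}]=\sum_{n\ge1}\kappa_X^{(n)}\frac{t^n}{n!}$ (for $t$ near $0$). For $1\le k\le n$, the partial Bell polynomial of order $(n,k)$ is $$B_{n,k}(a_1,\ldots,a_{n-k+1})=\frac{n!}{k!}\sum_{\substack{l_1+\cdots+l_k=n\\ l_1\ge1,\ldots,l_k\ge1}}\frac{a_{l_1}}{l_1!}\cdots\frac{a_{l_k}}{l_k!},$$ and the complete Bell polynomial of degree $n\ge 1$ is $B_n(a_1,\ldots,a_n)=\sum_{k=1}^n B_{n,k}(a_1,\ldots,a_{n-k+1})$. Note $B_{n,1}=a_n$. *)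

theory Defs
  imports "HOL-Probability.Probability"
begin

text \<open>
  The cumulant generating function is the logarithm of the moment generating function near \<open>0\<close>.
  Integrability is required explicitly because the Bochner integral of a non-integrable function
  is \<open>0\<close>. The entry at index \<open>0\<close> of a sequence of cumulants is irrelevant.
\<close>

definition has_cumulants :: "'a measure \<Rightarrow> ('a \<Rightarrow> real) \<Rightarrow> (nat \<Rightarrow> real) \<Rightarrow> bool" where
  "has_cumulants M X \<kappa> \<longleftrightarrow>
     (\<exists>r>0. \<forall>t. \<bar>t\<bar> < r \<longrightarrow>
        integrable M (\<lambda>\<omega>. exp (t * X \<omega>)) \<and>
        (\<lambda>n. \<kappa> (Suc n) * t ^ Suc n / fact (Suc n)) sums ln (\<integral>\<omega>. exp (t * X \<omega>) \<partial>M))"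

text \<open>Meaningful for \<open>n \<ge> 1\<close> when \<open>X\<close> has cumulants.\<close>

definition cumulant :: "'a measure \<Rightarrow> ('a \<Rightarrow> real) \<Rightarrow> nat \<Rightarrow> real" where
  "cumulant M X n = (THE c. \<exists>\<kappa>. has_cumulants M X \<kappa> \<and> \<kappa> n = c)"

lemma has_cumulants_unique:
  assumes "has_cumulants M X \<kappa>" "has_cumulants M X \<kappa>'" "n \<ge> 1"
  shows "\<kappa> n = \<kappa>' n"
proof -
  obtain r where r: "r > 0"
    "\<And>t. \<bar>t\<bar> < r \<Longrightarrow> (\<lambda>n. \<kappa> (Suc n) * t ^ Suc n / fact (Suc n)) sums ln (\<integral>\<omega>. exp (t * X \<omega>) \<partial>M)"
    using assms(1) unfolding has_cumulants_def by blast
  obtain s where s: "s > 0"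
    "\<And>t. \<bar>t\<bar> < s \<Longrightarrow> (\<lambda>n. \<kappa>' (Suc n) * t ^ Suc n / fact (Suc n)) sums ln (\<integral>\<omega>. exp (t * X \<omega>) \<partial>M)"
    using assms(2) unfolding has_cumulants_def by blast
  define a where "a = (\<lambda>n. if n = 0 then 0 else (\<kappa> n - \<kappa>' n) / fact n)"
  have sums_0: "(\<lambda>n. a n * t ^ n) sums 0" if "norm t < min r s" for t :: real
  proof -
    have "(\<lambda>n. \<kappa> (Suc n) * t ^ Suc n / fact (Suc n) - \<kappa>' (Suc n) * t ^ Suc n / fact (Suc n)) sums 0"
      using sums_diff[OF r(2) s(2), of t t] that by simp
    then have "(\<lambda>n. a (Suc n) * t ^ Suc n) sums 0"
      by (simp add: a_def diff_divide_distrib left_diff_distrib del: fact_Suc power_Suc)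
    then show ?thesis
      by (subst (asm) sums_Suc_iff) (simp add: a_def)
  qed
  have "a n = 0"
  proof (induction n rule: less_induct)
    case (less n)
    have "((\<lambda>_. 0) \<longlongrightarrow> a (0 + n)) (at (0::real))"
    proof (rule powser_limit_0_strong[where s = "min r s" and a = "\<lambda>m. a (m + n)"])
      show "0 < min r s" using r(1) s(1) by simp
      fix t :: real
      assume t: "t \<noteq> 0" "norm t < min r s"
      have "(\<lambda>m. a (m + n) * t ^ (m + n)) sums 0"
        using sums_split_initial_segment[OF sums_0[OF t(2)], of n] less.IH by simp
      then have "(\<lambda>m. a (m + n) * t ^ (m + n) / t ^ n) sums (0 / t ^ n)"
        by (rule sums_divide)
      then show "(\<lambda>m. a (m + n) * t ^ m) sums 0"
        using t(1) by (simp add: power_add)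
    qed
    then show "a n = 0"
      using tendsto_unique[of "at (0::real)" "\<lambda>_. 0" 0 "a n"] by simp
  qed
  then show ?thesis using assms(3) by (simp add: a_def)
qed

lemma cumulant_eq:
  assumes "has_cumulants M X \<kappa>" "n \<ge> 1"
  shows "cumulant M X n = \<kappa> n"
  unfolding cumulant_def using assms has_cumulants_unique by (intro the_equality) blast+

text \<open>The summation ranges over the compositions \<open>[l\<^sub>1, \<dots>, l\<^sub>k]\<close> of \<open>n\<close>.\<close>

definition partial_bell :: "nat \<Rightarrow> nat \<Rightarrow> (nat \<Rightarrow> real) \<Rightarrow> real" where
  "partial_bell n k a = fact n / fact k *
     (\<Sum>l \<in> {l :: nat list. length l = k \<and> (\<forall>i\<in>set l. 1 \<le> i) \<and> sum_list l = n}.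
        \<Prod>i\<leftarrow>l. a i / fact i)"

definition complete_bell :: "nat \<Rightarrow> (nat \<Rightarrow> real) \<Rightarrow> real" where
  "complete_bell n a = (\<Sum>k=1..n. partial_bell n k a)"

lemma finite_compositions:
  "finite {l :: nat list. length l = k \<and> (\<forall>i\<in>set l. 1 \<le> i) \<and> sum_list l = n}"
  by (rule finite_subset[OF _ finite_lists_length_eq[of "{..n}" k]])
     (auto dest: member_le_sum_list)

lemma partial_bell_cong:
  assumes "\<And>i. 1 \<le> i \<Longrightarrow> i \<le> n - k + 1 \<Longrightarrow> a i = b i"
  shows "partial_bell n k a = partial_bell n k b"
proof -
  have bound: "i \<le> n - k + 1" if "\<forall>j\<in>set l. 1 \<le> j" "i \<in> set l" "sum_list l = n" "length l = k" 
    for l :: "nat list" and i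
  proof -
    have "length xs \<le> sum_list xs" if "\<forall>j\<in>set xs. 1 \<le> j" for xs :: "nat list"
      using that by (induction xs) auto
    then have "length (remove1 i l) \<le> sum_list (remove1 i l)"
      using that(1) notin_set_remove1 by metis
    moreover have "sum_list l = i + sum_list (remove1 i l)"
      using that(2) by (simp add: sum_list_map_remove1[of _ _ "\<lambda>x. x", simplified])
    ultimately show ?thesis
      using that by (auto simp: length_remove1)
  qed
  show ?thesis
    unfolding partial_bell_def
    by (intro arg_cong[where f = "\<lambda>x. fact n / fact k * x"] sum.cong refl
              arg_cong[where f = prod_list] map_cong)
       (use assms bound in auto)
qed

lemma partial_bell_1:
  assumes "n \<ge> 1"
  shows "partial_bell n 1 a = a n"
proof -
  have "{l :: nat list. length l = 1 \<and> (\<forall>i\<in>set l. 1 \<le> i) \<and> sum_list l = n} = {[n]}"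
    using assms by (auto simp: length_Suc_conv)
  then show ?thesis by (simp add: partial_bell_def)
qed

end

theory Submission
  imports Defs "HOL-Complex_Analysis.Laurent_Convergence"
begin

text \<open>
  Let \<open>T(x) = \<Sum>\<^sub>n n\<^sup>n\<^sup>-\<^sup>1 x\<^sup>n / n!\<close> be the tree function. Formally \<open>T\<close> is the compositional inverse of
  \<open>x e\<^sup>-\<^sup>x\<close>, hence \<open>T(x) e\<^bsup>-T(x)\<^esup> = x\<close> on its disc of convergence \<open>\<bar>x\<bar> < e\<^sup>-\<^sup>1\<close>. Since
  \<open>x \<mapsto> x e\<^sup>-\<^sup>x\<close> is injective on \<open>(0, 1)\<close>, this gives \<open>T(\<mu> e\<^bsup>-\<mu>\<^esup>) = \<mu>\<close>: the Borel masses add up to \<open>1\<close>,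
  so \<open>X\<close> is almost surely a positive integer, and its moment generating function is
  \<open>T(\<mu> e\<^bsup>-\<mu>\<^esup> e\<^sup>t) / \<mu>\<close> for \<open>t\<close> near \<open>0\<close>. The functional equation of \<open>T\<close> then says that the cumulant
  generating function satisfies \<open>K(t) = t + \<mu> (e\<^bsup>K(t)\<^esup> - 1)\<close>, and the recursion results from comparing
  coefficients, the complete Bell polynomials being the coefficients of \<open>e\<^bsup>K(t)\<^esup>\<close>.
\<close>

unbundle no vec_syntax

section \<open>A finite difference identity\<close>

lemma alternating_binomial_power_sum:
  assumes "m < N"
  shows "(\<Sum>k\<le>N. of_nat (N choose k) * (-1) ^ (N - k) * of_nat k ^ m) = (0::'a::field_char_0)"
proof -
  \<comment> \<open>The sum is \<open>m!\<close> times the \<open>m\<close>-th coefficient of \<open>(e\<^sup>x - 1)\<^sup>N\<close>, which has order \<open>N\<close>.\<close>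
  have "(fps_exp 1 + (-1) :: 'a fps) ^ N $ m = 0"
    using startsby_zero_power_prefix[of "fps_exp 1 + (-1) :: 'a fps" N] assms by simp
  moreover have "(fps_exp 1 + (-1) :: 'a fps) ^ N =
      (\<Sum>k\<le>N. fps_const (of_nat (N choose k) * (-1) ^ (N - k)) * fps_exp (of_nat k))"
    by (subst binomial_ring, intro sum.cong refl)
       (simp add: fps_exp_power_mult mult_ac
         flip: fps_const_mult fps_const_power fps_of_nat fps_const_neg)
  ultimately have "(\<Sum>k\<le>N. of_nat (N choose k) * (-1) ^ (N - k) * (of_nat k ^ m / fact m)) = (0::'a)"
    by (simp add: fps_sum_nth)
  then have "(\<Sum>k\<le>N. of_nat (N choose k) * (-1) ^ (N - k) * of_nat k ^ m) / fact m = (0::'a)"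
    by (simp add: sum_divide_distrib)
  then show ?thesis by simp
qed

section \<open>The tree function\<close>

definition tree_fps :: "complex fps" where
  "tree_fps = Abs_fps (\<lambda>n. if n = 0 then 0 else of_nat n ^ (n - 1) / fact n)"

lemma tree_fps_nth_0: "tree_fps $ 0 = 0"
  by (simp add: tree_fps_def)

text \<open>Up to the factor \<open>fact N\<close>, the coefficient at \<open>N\<close> is an
  \<open>N\<close>-th finite difference of the power \<open>N - 1\<close>. It vanishes because the
  degree is below the order.\<close>

lemma tree_fps_compose: "tree_fps oo (fps_X * fps_exp (-1)) = fps_X"
proof (rule fps_ext)
  fix N :: nat
  have power_nth: "(fps_X * fps_exp (-1) :: complex fps) ^ i $ N =
      (-1) ^ (N - i) * of_nat i ^ (N - i) / fact (N - i)" if "i \<le> N" for i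
    using that
    by (simp add: power_mult_distrib fps_X_power_mult_nth fps_exp_power_mult power_minus')
  have "(tree_fps oo (fps_X * fps_exp (-1))) $ N =
      (\<Sum>i\<le>N. tree_fps $ i * ((-1) ^ (N - i) * of_nat i ^ (N - i) / fact (N - i)))"
    by (simp add: fps_compose_nth power_nth atLeast0AtMost)
  also have "\<dots> = fps_X $ N"
  \<comment> \<open>For \<open>N \<le> 1\<close> the term of that difference at \<open>i = 0\<close>
    would contain \<open>0 ^ 0 = 1\<close>, whereas \<open>tree_fps $ 0 = 0\<close>.\<close>
  proof (cases "N \<le> 1")
    case True
    then consider "N = 0" | "N = 1" by linarith
    then show ?thesis by cases (simp_all add: tree_fps_def)
  next
    case False
    have "(\<Sum>i\<le>N. tree_fps $ i * ((-1) ^ (N - i) * of_nat i ^ (N - i) / fact (N - i))) =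
        (\<Sum>i\<le>N. of_nat (N choose i) * (-1) ^ (N - i) * of_nat i ^ (N - 1) / fact N)"
    proof (rule sum.cong)
      fix i assume "i \<in> {..N}"
      then have "i \<le> N" by simp
      have "(of_nat i :: complex) ^ (N - 1) = of_nat i ^ (i - 1) * of_nat i ^ (N - i)" if "i > 0"
        using that \<open>i \<le> N\<close> by (simp flip: power_add)
      then show "tree_fps $ i * ((-1) ^ (N - i) * of_nat i ^ (N - i) / fact (N - i)) =
          of_nat (N choose i) * (-1) ^ (N - i) * of_nat i ^ (N - 1) / fact N"
        using \<open>i \<le> N\<close> False by (auto simp: tree_fps_def binomial_fact)
    qed simp
    also have "\<dots> = 0"
      using False alternating_binomial_power_sum[of "N - 1" N, where 'a = complex]
      by (simp flip: sum_divide_distrib)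
    finally show ?thesis using False by simp
  qed
  finally show "(tree_fps oo (fps_X * fps_exp (-1))) $ N = fps_X $ N" .
qed

text \<open>A left inverse agrees with a right inverse: \<open>?b\<close> has a nonzero linear
  coefficient, so \<open>fps_inv ?b\<close> is a right inverse, and associativity identifies it with
  \<open>tree_fps\<close>. This order of composition becomes the functional equation.\<close>

lemma compose_tree_fps: "(fps_X * fps_exp (-1)) oo tree_fps = fps_X"
proof -
  let ?b = "fps_X * fps_exp (-1) :: complex fps"
  have b: "?b $ 0 = 0" "?b $ 1 \<noteq> 0" by simp_all
  have inv: "?b oo fps_inv ?b = fps_X"
    by (rule fps_inv_right[OF b])
  have "tree_fps = tree_fps oo (?b oo fps_inv ?b)"
    by (simp add: inv)
  also have "\<dots> = fps_inv ?b"
    by (subst fps_compose_assoc) (simp_all add: tree_fps_compose fps_inv_def)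
  finally show ?thesis using inv by simp
qed

section \<open>Convergence and the functional equation\<close>

lemma power_self_le_exp_fact: "real n ^ n / fact n \<le> exp (real n)"
proof -
  have "(\<lambda>k. real n ^ k / fact k) sums exp (real n)"
    using exp_converges[of "real n"] by (simp add: field_simps)
  then show ?thesis
    by (intro sums_le[OF _ sums_single[of n "\<lambda>k. real n ^ k / fact k"]]) auto
qed

text \<open>Keeping a single term of the exponential series replaces Stirling's formula; growth rate
  e suffices for the radius \<open>exp (-1)\<close>.\<close>

lemma norm_tree_fps_le: "norm (tree_fps $ n) \<le> exp (real n)"
proof (cases "n = 0")
  case False
  then have "real n ^ (n - 1) \<le> real n ^ n"
    by (intro power_increasing) auto
  then have "real n ^ (n - 1) / fact n \<le> real n ^ n / fact n"
    by (intro divide_right_mono) auto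
  then show ?thesis
    using power_self_le_exp_fact[of n] False by (simp add: tree_fps_def norm_divide norm_power)
qed (simp add: tree_fps_def)

lemma conv_radius_tree_fps: "fps_conv_radius tree_fps \<ge> exp (-1)"
  unfolding fps_conv_radius_def
proof (rule conv_radius_geI_ex')
  fix r :: real
  assume r: "0 < r" "ereal r < ereal (exp (-1))"
  then have "exp 1 * r < exp 1 * exp (-1)"
    by simp
  then have "exp 1 * r < 1"
    by (simp flip: exp_add)
  then have "summable (\<lambda>n. (exp 1 * r) ^ n)"
    using r by (intro summable_geometric) auto
  then show "summable (\<lambda>n. tree_fps $ n * of_real r ^ n)"
  proof (rule summable_comparison_test')
    fix n :: nat
    show "norm (tree_fps $ n * of_real r ^ n) \<le> (exp 1 * r) ^ n"
      using r norm_tree_fps_le[of n]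
      by (simp add: norm_mult norm_power power_mult_distrib flip: exp_of_nat_mult)
  qed
qed

lemma tree_fps_radius: "norm z < exp (-1) \<Longrightarrow> ereal (norm z) < fps_conv_radius tree_fps"
  using conv_radius_tree_fps by (metis ereal_less_eq(3) less_ereal.simps(1) order_less_le_trans)

definition tree_fun :: "complex \<Rightarrow> complex" where
  "tree_fun = eval_fps tree_fps"

lemma tree_fun_holomorphic: "tree_fun holomorphic_on ball 0 (exp (-1))"
  unfolding tree_fun_def
proof (rule holomorphic_on_eval_fps, rule subsetI)
  fix z :: complex
  assume "z \<in> ball 0 (exp (-1))"
  then show "z \<in> eball 0 (fps_conv_radius tree_fps)"
    using tree_fps_radius[of z] by simp
qed

lemma tree_fun_sums: "norm z < exp (-1) \<Longrightarrow> (\<lambda>n. tree_fps $ n * z ^ n) sums tree_fun z"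
  unfolding tree_fun_def by (rule sums_eval_fps[OF tree_fps_radius])

lemma tree_fun_0 [simp]: "tree_fun 0 = 0"
  by (simp add: tree_fun_def eval_fps_at_0 tree_fps_def)

text \<open>Composing formal series gives the identity only near 0. Both sides are holomorphic on
  the disc, so analytic continuation extends it.\<close>

lemma tree_fun_eq:
  assumes "norm z < exp (-1)"
  shows "tree_fun z * exp (- tree_fun z) = z"
proof -
  have "ereal 0 < fps_conv_radius tree_fps"
    using tree_fps_radius[of 0] by simp
  then have "tree_fun has_fps_expansion tree_fps"
    unfolding tree_fun_def by (intro eval_fps_has_fps_expansion) (simp add: zero_ereal_def)
  moreover have "(\<lambda>w::complex. w * exp (- w)) has_fps_expansion fps_X * fps_exp (-1)"
    by (intro fps_expansion_intros)
  ultimately have "((\<lambda>w. w * exp (- w)) \<circ> tree_fun) has_fps_expansion fps_X"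
    using has_fps_expansion_compose[of "\<lambda>w. w * exp (- w)" "fps_X * fps_exp (-1)" tree_fun tree_fps]
      compose_tree_fps tree_fps_nth_0 by simp
  then have "eventually (\<lambda>z. z = tree_fun z * exp (- tree_fun z)) (nhds 0)"
    by (simp add: has_fps_expansion_def)
  then obtain e where e: "e > 0" "\<And>z. z \<in> ball 0 e \<Longrightarrow> z = tree_fun z * exp (- tree_fun z)"
    by (auto simp: eventually_nhds_metric dist_commute)
  show ?thesis
  proof (rule analytic_continuation_open[of "ball 0 (min e (exp (-1)))" "ball 0 (exp (-1))"])
    show "(\<lambda>z. tree_fun z * exp (- tree_fun z)) holomorphic_on ball 0 (exp (-1))"
      by (intro holomorphic_intros tree_fun_holomorphic)
    show "ball 0 (min e (exp (-1))) \<noteq> ({} :: complex set)"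
      using e(1) by (simp add: not_le)
  qed (use e assms in \<open>auto intro!: holomorphic_intros\<close>)
qed

section \<open>The tree function on the real axis\<close>

lemma eval_fps_cnj:
  assumes "ereal (norm z) < fps_conv_radius F"
  shows "eval_fps (Abs_fps (\<lambda>n. cnj (F $ n))) z = cnj (eval_fps F (cnj z))"
proof -
  have "(\<lambda>n. F $ n * cnj z ^ n) sums eval_fps F (cnj z)"
    using assms by (intro sums_eval_fps) simp
  then have "(\<lambda>n. cnj (F $ n * cnj z ^ n)) sums cnj (eval_fps F (cnj z))"
    by (simp only: sums_cnj)
  then show ?thesis
    by (simp add: eval_fps_def sums_iff)
qed

lemma tree_fun_cnj:
  assumes "norm z < exp (-1)"
  shows "tree_fun (cnj z) = cnj (tree_fun z)"
proof -
  have "Abs_fps (\<lambda>n. cnj (tree_fps $ n)) = tree_fps"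
    by (simp add: tree_fps_def fps_eq_iff)
  then show ?thesis
    using eval_fps_cnj[OF tree_fps_radius, of "cnj z"] assms by (simp add: tree_fun_def)
qed

lemma tree_fun_of_real:
  assumes "\<bar>x\<bar> < exp (-1)"
  shows "tree_fun (of_real x) = of_real (Re (tree_fun (of_real x)))"
  using tree_fun_cnj[of "of_real x"] assms by (simp add: Reals_cnj_iff of_real_Re)

lemma Re_tree_fun_eq:
  assumes "\<bar>x\<bar> < exp (-1)"
  shows "Re (tree_fun (of_real x)) * exp (- Re (tree_fun (of_real x))) = x"
proof -
  define u where "u = Re (tree_fun (of_real x))"
  have "of_real u * exp (- of_real u) = complex_of_real x"
    using tree_fun_eq[of "of_real x"] tree_fun_of_real[OF assms] assms by (simp add: u_def)
  then have "complex_of_real (u * exp (- u)) = of_real x"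
    by (simp flip: exp_of_real)
  then show ?thesis
    unfolding u_def of_real_eq_iff .
qed

text \<open>This amounts to \<open>x < exp (x - 1)\<close>, that is, to
  \<open>ln x \<le> x - 1\<close> with equality only at 1. It places
  \<open>\<mu> * exp (- \<mu>)\<close> inside the disc.\<close>

lemma mult_exp_minus_lt:
  assumes "x \<noteq> (1::real)"
  shows "x * exp (- x) < exp (-1)"
proof -
  have "x < exp (x - 1)"
  proof (cases "x > 0")
    case True
    then have "ln x < x - 1"
      using assms ln_eq_minus_one[of x] ln_le_minus_one[of x] by fastforce
    then show ?thesis using True by (metis exp_less_mono exp_ln)
  next
    case False
    then show ?thesis using exp_gt_zero[of "x - 1"] by linarith
  qed
  then have "x * exp (- x) < exp (x - 1) * exp (- x)"
    by simp
  then show ?thesis by (simp flip: exp_add)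
qed

text \<open>By symmetry \<open>u \<le> v\<close>. Then \<open>u = v * exp (u - v)\<close>, and the
  tangent bound on exp yields \<open>(v - u) * (1 - v) \<le> 0\<close>, which forces equality since
  \<open>v < 1\<close>.\<close>

lemma mult_exp_minus_inj:
  assumes "u * exp (- u) = v * exp (- v)" "0 < u" "u < 1" "0 < v" "v < (1::real)"
  shows "u = v"
  using assms
proof (induction u v rule: linorder_wlog)
  case (le u v)
  have "u = v * exp (u - v)"
    using le.prems(1) by (simp add: exp_diff exp_minus field_simps)
  then have "v * (1 + (u - v)) \<le> u"
    using exp_ge_add_one_self[of "u - v"] le.prems
    by (metis less_imp_le mult_left_mono)
  then have "(v - u) * (1 - v) \<le> 0"
    by (simp add: algebra_simps)
  then show ?case
    using le by (simp add: mult_le_0_iff)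
qed simp

text \<open>This selects the branch, since \<open>u * exp (- u) = x\<close> with
  \<open>x > 0\<close> also has a root above 1. Starting from 0 at 0, the tree function would have
  to take the value 1 at some \<open>y \<le> x\<close>, and the functional equation would give
  \<open>y = exp (-1)\<close>.\<close>

lemma Re_tree_fun_lt_1:
  assumes "0 \<le> x" "x < exp (-1)"
  shows "Re (tree_fun (of_real x)) < 1"
proof (rule ccontr)
  assume "\<not> ?thesis"
  moreover have "continuous_on {0..x} (\<lambda>y. Re (tree_fun (of_real y)))"
    by (intro continuous_intros continuous_on_compose2[OF holomorphic_on_imp_continuous_on
          [OF tree_fun_holomorphic]]) (use assms in auto)
  ultimately obtain y where "0 \<le> y" "y \<le> x" "Re (tree_fun (of_real y)) = 1"
    using IVT'[of "\<lambda>y. Re (tree_fun (of_real y))" 0 1 x] assms by auto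
  then show False
    using Re_tree_fun_eq[of y] assms by simp
qed

lemma tree_fun_mult_exp_minus:
  assumes "0 < \<mu>" "\<mu> < 1"
  shows "tree_fun (of_real (\<mu> * exp (- \<mu>))) = of_real \<mu>"
proof -
  let ?x = "\<mu> * exp (- \<mu>)"
  have x: "0 < ?x" "?x < exp (-1)"
    using assms mult_exp_minus_lt[of \<mu>] by auto
  have eq: "Re (tree_fun (of_real ?x)) * exp (- Re (tree_fun (of_real ?x))) = ?x"
    using x by (intro Re_tree_fun_eq) auto
  then have "0 < Re (tree_fun (of_real ?x))"
    using x(1) by (metis exp_gt_zero zero_less_mult_pos2)
  then have "Re (tree_fun (of_real ?x)) = \<mu>"
    using x assms Re_tree_fun_lt_1[of ?x] by (intro mult_exp_minus_inj[OF eq]) auto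
  then show ?thesis
    using tree_fun_of_real[of ?x] x by simp
qed

text \<open>The constant term is 0, so the series may start at index 1, where its terms line up with
  the Borel masses.\<close>

lemma Re_tree_fun_sums:
  assumes "\<bar>x\<bar> < exp (-1)"
  shows "(\<lambda>n. real (Suc n) ^ n / fact (Suc n) * x ^ Suc n) sums Re (tree_fun (of_real x))"
proof -
  have "(\<lambda>n. tree_fps $ Suc n * of_real x ^ Suc n) sums tree_fun (of_real x)"
    using tree_fun_sums[of "of_real x"] assms sums_Suc_iff[of "\<lambda>n. tree_fps $ n * of_real x ^ n"]
    by (simp add: tree_fps_nth_0)
  moreover have "tree_fps $ Suc n * of_real x ^ Suc n =
      of_real (real (Suc n) ^ n / fact (Suc n) * x ^ Suc n)" for n
    by (simp add: tree_fps_def del: of_nat_Suc fact_Suc)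
  ultimately have "(\<lambda>n. complex_of_real (real (Suc n) ^ n / fact (Suc n) * x ^ Suc n)) sums
      tree_fun (of_real x)"
    by (simp only:)
  from sums_Re[OF this] show ?thesis
    by (simp only: Re_complex_of_real)
qed

section \<open>Bell polynomials and discrete expectations\<close>

lemma partial_bell_eq_fps_power:
  assumes "k \<ge> 1"
  shows "partial_bell n k a =
    fact n / fact k * (Abs_fps (\<lambda>i. if i = 0 then 0 else a i / fact i) ^ k) $ n"
proof -
  let ?A = "Abs_fps (\<lambda>i. if i = 0 then 0 else a i / fact i)"
  let ?C = "{l :: nat list. length l = k \<and> (\<forall>i\<in>set l. 1 \<le> i) \<and> sum_list l = n}"
  have prod_eq: "(\<Prod>j = 0..k - 1. ?A $ (v ! j)) = (\<Prod>i\<leftarrow>v. ?A $ i)" if "length v = k" for v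
    using that assms
    by (subst prod.list_conv_set_nth) (auto intro!: prod.cong simp del: fps_nth_Abs_fps)
  have "(?A ^ k) $ n = (\<Sum>v\<in>natpermute n k. \<Prod>i\<leftarrow>v. ?A $ i)"
    using assms by (auto simp: fps_power_nth natpermute_def simp del: fps_nth_Abs_fps simp flip: One_nat_def intro!: sum.cong prod_eq)
  \<comment> \<open>\<open>natpermute n k\<close> admits lists with zero entries; these contribute 0
    because \<open>?A\<close> has no constant term.\<close>
  also have "\<dots> = (\<Sum>v\<in>?C. \<Prod>i\<leftarrow>v. ?A $ i)"
    by (intro sum.mono_neutral_right natpermute_finite)
       (auto simp: natpermute_def prod_list_zero_iff image_iff Suc_le_eq intro!: gr0I)
  also have "\<dots> = (\<Sum>v\<in>?C. \<Prod>i\<leftarrow>v. a i / fact i)"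
    by (intro sum.cong refl arg_cong[where f = prod_list] map_cong) auto
  finally show ?thesis by (simp add: partial_bell_def)
qed

section \<open>Random variables with values in the positive integers\<close>

lemma (in prob_space) AE_range_of_sums_1:
  assumes "X \<in> borel_measurable M" "(\<lambda>n. prob {\<omega> \<in> space M. X \<omega> = real (Suc n)}) sums 1"
  shows "AE \<omega> in M. \<exists>n. X \<omega> = real (Suc n)"
proof -
  let ?E = "\<lambda>n. {\<omega> \<in> space M. X \<omega> = real (Suc n)}"
  have "(\<lambda>n. prob (?E n)) sums prob (\<Union>n. ?E n)"
    using assms(1) by (intro finite_measure_UNION) (auto simp: disjoint_family_on_def)
  then have "prob (\<Union>n. ?E n) = 1"
    using assms(2) sums_unique2 by blast
  from AE_prob_1[OF this] show ?thesis
    by eventually_elim auto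
qed

text \<open>Almost everywhere \<open>g (X \<omega>)\<close> is the sum of its values on the disjoint
  events \<open>?E n\<close>; absolute summability allows integration term by term.\<close>

lemma (in prob_space) expectation_of_range:
  fixes g :: "real \<Rightarrow> real"
  assumes X: "X \<in> borel_measurable M" and range: "AE \<omega> in M. \<exists>n. X \<omega> = real (Suc n)"
    and g: "g \<in> borel_measurable borel"
    and summable: "summable (\<lambda>n. \<bar>g (real (Suc n))\<bar> * prob {\<omega> \<in> space M. X \<omega> = real (Suc n)})"
  shows "integrable M (\<lambda>\<omega>. g (X \<omega>))"
    and "(\<lambda>n. g (real (Suc n)) * prob {\<omega> \<in> space M. X \<omega> = real (Suc n)}) sums
           expectation (\<lambda>\<omega>. g (X \<omega>))"
proof -
  let ?E = "\<lambda>n. {\<omega> \<in> space M. X \<omega> = real (Suc n)}"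
  let ?f = "\<lambda>n \<omega>. g (real (Suc n)) * indicator (?E n) \<omega>"
  have [measurable]: "?E n \<in> events" for n
    using X by measurable
  have int: "integrable M (?f n)" for n
    by (rule integrable_mult_right, rule integrable_real_indicator) (simp_all del: of_nat_Suc add: emeasure_eq_measure)
  \<comment> \<open>Only the index \<open>m\<close> contributes at this outcome. Taking
    \<open>h\<close> to be the norm gives absolute summability, taking it to be the identity gives
    the value.\<close>
  have fin: "(\<lambda>n. h (?f n \<omega>)) sums h (g (X \<omega>))"
    if "\<omega> \<in> space M" "X \<omega> = real (Suc m)" "h 0 = 0" for h :: "real \<Rightarrow> real" and \<omega> m
  proof -
    have "(\<lambda>n. h (?f n \<omega>)) = (\<lambda>n. if n = m then h (g (X \<omega>)) else 0)"
      using that by (auto simp: indicator_def)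
    then show ?thesis using sums_single[of m "\<lambda>_. h (g (X \<omega>))"] by (simp only:)
  qed
  have sum1: "AE \<omega> in M. summable (\<lambda>n. norm (?f n \<omega>))"
    using range AE_space by eventually_elim (use fin[of _ _ norm] in \<open>auto simp: sums_iff\<close>)
  have sum2: "summable (\<lambda>n. \<integral>\<omega>. norm (?f n \<omega>) \<partial>M)"
    using summable sets.sets_into_space[OF \<open>?E _ \<in> events\<close>]
    by (simp add: abs_mult Int_absorb2 del: of_nat_Suc)
  have AE_eq: "AE \<omega> in M. (\<Sum>n. ?f n \<omega>) = g (X \<omega>)"
    using range AE_space by eventually_elim (use fin[of _ _ "\<lambda>x. x"] in \<open>auto simp: sums_iff\<close>)
  have meas: "(\<lambda>\<omega>. \<Sum>n. ?f n \<omega>) \<in> borel_measurable M" "(\<lambda>\<omega>. g (X \<omega>)) \<in> borel_measurable M"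
    using X g by measurable
  show "integrable M (\<lambda>\<omega>. g (X \<omega>))"
    using integrable_cong_AE[OF meas AE_eq] integrable_suminf[OF int sum1 sum2] by blast
  have "(\<lambda>n. integral\<^sup>L M (?f n)) sums (\<integral>\<omega>. (\<Sum>n. ?f n \<omega>) \<partial>M)"
    by (rule sums_integral[OF int sum1 sum2])
  also have "(\<integral>\<omega>. (\<Sum>n. ?f n \<omega>) \<partial>M) = expectation (\<lambda>\<omega>. g (X \<omega>))"
    by (rule integral_cong_AE[OF meas AE_eq])
  finally show "(\<lambda>n. g (real (Suc n)) * prob (?E n)) sums expectation (\<lambda>\<omega>. g (X \<omega>))"
    using sets.sets_into_space[OF \<open>?E _ \<in> events\<close>]
    by (simp add: Int_absorb2 del: of_nat_Suc)
qed

section \<open>Cumulants of the Borel distribution\<close>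

lemma fps_power_of_real_nth:
  assumes "\<And>n. F $ n = complex_of_real (P $ n)"
  shows "(F ^ k) $ n = complex_of_real ((P ^ k) $ n)"
proof (induction k arbitrary: n)
  case (Suc k)
  then show ?case by (simp add: fps_mult_nth assms)
qed simp

text \<open>Conjugating the coefficients gives the series of \<open>cnj (f (cnj z))\<close>, which
  is \<open>f z\<close> near 0; by uniqueness the coefficients are self-conjugate.\<close>

lemma has_fps_expansion_real_coeff:
  fixes f :: "complex \<Rightarrow> complex"
  assumes F: "f has_fps_expansion F"
    and cnj: "eventually (\<lambda>z. f (cnj z) = cnj (f z)) (nhds 0)"
  shows "F $ n = of_real (Re (F $ n))"
proof -
  let ?G = "Abs_fps (\<lambda>n. cnj (F $ n))"
  have radius: "fps_conv_radius ?G = fps_conv_radius F"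
    unfolding fps_conv_radius_def by (rule conv_radius_cong) simp
  have pos: "0 < fps_conv_radius F" and ev: "eventually (\<lambda>z. eval_fps F z = f z) (nhds 0)"
    using F by (auto simp: has_fps_expansion_def)
  have "filterlim cnj (nhds 0) (nhds 0)"
    using tendsto_cnj[OF filterlim_ident, of 0] by simp
  then have "eventually (\<lambda>z. eval_fps F (cnj z) = f (cnj z)) (nhds 0)"
    using ev eventually_compose_filterlim by blast
  moreover have "eventually (\<lambda>z. z \<in> eball 0 (fps_conv_radius F)) (nhds 0)"
    using pos by (intro eventually_nhds_in_open) (auto simp: zero_ereal_def)
  ultimately have "eventually (\<lambda>z. eval_fps ?G z = eval_fps F z) (nhds 0)"
    using ev cnj by eventually_elim (simp add: eval_fps_cnj)
  then have "?G = F"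
    by (intro eval_fps_eqD) (simp_all add: radius pos)
  then have "cnj (F $ n) = F $ n"
    by (metis fps_nth_Abs_fps)
  then show ?thesis
    by (metis Reals_cnj_iff of_real_Re)
qed

text \<open>\<open>P\<close> is the expansion of K. Holomorphy supplies a convergent complex series,
  conjugation symmetry makes it real, and the recursion compares coefficients in K(t) = t + \<mu>
  (exp K(t) - 1).\<close>

lemma borel_log_mgf_expansion:
  assumes "0 < \<mu>" "\<mu> < 1"
  obtains r and P :: "real fps" where "r > 0" "P $ 0 = 0"
    "\<And>n. P $ n = (if n = 1 then 1 else 0) + \<mu> * (\<Sum>k=1..n. (P ^ k) $ n / fact k)"
    "\<And>t. \<bar>t\<bar> < r \<Longrightarrow> \<mu> * exp (- \<mu>) * exp t < exp (-1)"
    "\<And>t. \<bar>t\<bar> < r \<Longrightarrow>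
      (\<lambda>n. P $ n * t ^ n) sums ln (Re (tree_fun (of_real (\<mu> * exp (- \<mu>) * exp t))) / \<mu>)"
proof -
  let ?x = "\<mu> * exp (- \<mu>)"
  define S where "S = {t :: complex. norm (of_real ?x * exp t) < exp (-1)}"
  \<comment> \<open>With \<tau> the tree function at \<open>?x * exp t\<close>, the equation \<tau>
    = \<open>?x * exp t\<close> * exp \<tau> gives \<tau> / \<mu> = exp (t + \<tau> - \<mu>). The
    exponent serves as a logarithm without any choice of complex branch.\<close>
  define f where "f = (\<lambda>t. t + tree_fun (of_real ?x * exp t) - of_real \<mu>)"
  have x: "0 < ?x" "?x < exp (-1)"
    using assms mult_exp_minus_lt[of \<mu>] by auto
  have "open S"
    unfolding S_def by (intro open_Collect_less continuous_intros)
  moreover have "0 \<in> S"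
    using x assms by (simp add: S_def norm_mult)
  ultimately have ev_S: "eventually (\<lambda>t. t \<in> S) (nhds 0)"
    by (intro eventually_nhds_in_open)
  have "(\<lambda>t. tree_fun (of_real ?x * exp t)) holomorphic_on S"
    by (intro holomorphic_on_compose_gen[OF _ tree_fun_holomorphic, unfolded o_def] holomorphic_intros)
       (auto simp: S_def)
  then have "f holomorphic_on S"
    unfolding f_def by (intro holomorphic_intros)
  then have "f analytic_on {0}"
    using \<open>open S\<close> \<open>0 \<in> S\<close> analytic_at by blast
  then obtain F where F: "f has_fps_expansion F"
    using analytic_at_imp_has_fps_expansion_0 by blast
  \<comment> \<open>The zero constant term of \<open>F\<close> is what makes the composition
    \<open>fps_exp 1 oo F\<close> legitimate.\<close>
  have f_0: "f 0 = 0"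
    using tree_fun_mult_exp_minus[OF assms] by (simp add: f_def)
  then have F_0: "F $ 0 = 0"
    using fps_nth_fps_expansion[OF F, of 0] by simp
  have exp_f: "of_real \<mu> * exp (f t) = tree_fun (of_real ?x * exp t)" if "t \<in> S" for t
  proof -
    let ?\<tau> = "tree_fun (of_real ?x * exp t)"
    have "of_real \<mu> * exp (f t) = (of_real ?x * exp t) * exp ?\<tau>"
      by (simp add: f_def exp_add exp_diff exp_minus exp_of_real field_simps)
    also have "\<dots> = ?\<tau> * exp (- ?\<tau>) * exp ?\<tau>"
      using tree_fun_eq[of "of_real ?x * exp t"] that by (simp add: S_def)
    finally show ?thesis by (simp add: mult.assoc flip: exp_add)
  qed
  \<comment> \<open>Replacing the tree function in the definition of \<open>f\<close> by
    \<open>exp_f\<close> yields a fixed-point equation for \<open>f\<close>.\<close>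
  have "(\<lambda>t. t + of_real \<mu> * ((exp \<circ> f) t - 1)) has_fps_expansion
      fps_X + fps_const (of_real \<mu>) * ((fps_exp 1 oo F) - 1)"
    by (intro fps_expansion_intros F F_0)
  moreover have "eventually (\<lambda>t. t + of_real \<mu> * ((exp \<circ> f) t - 1) = f t) (nhds 0)"
    using ev_S by eventually_elim (simp add: right_diff_distrib exp_f, simp add: f_def)
  ultimately have "f has_fps_expansion fps_X + fps_const (of_real \<mu>) * ((fps_exp 1 oo F) - 1)"
    by (subst (asm) has_fps_expansion_cong) auto
  then have F_eq: "F = fps_X + fps_const (of_real \<mu>) * ((fps_exp 1 oo F) - 1)"
    using F fps_expansion_unique_complex by blast
  define P where "P = Abs_fps (\<lambda>n. Re (F $ n))"
  have "eventually (\<lambda>t. f (cnj t) = cnj (f t)) (nhds 0)"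
    using ev_S
  proof eventually_elim
    case (elim t)
    then show ?case
      using tree_fun_cnj[of "of_real ?x * exp t"] by (simp add: f_def S_def exp_cnj)
  qed
  then have FP: "F $ n = of_real (P $ n)" for n
    using has_fps_expansion_real_coeff[OF F] by (simp add: P_def)
  have P_eq: "P $ n = (if n = 1 then 1 else 0) + \<mu> * (\<Sum>k=1..n. (P ^ k) $ n / fact k)" for n
  proof -
    have "F $ n = (if n = 1 then 1 else 0) + of_real \<mu> * ((\<Sum>k=0..n. (F ^ k) $ n / fact k) - 1 $ n)"
      by (subst F_eq) (simp add: fps_compose_nth)
    \<comment> \<open>Subtracting 1 cancels the summand \<open>k = 0\<close>.\<close>
    also have "(\<Sum>k=0..n. (F ^ k) $ n / fact k) - 1 $ n = (\<Sum>k=1..n. (F ^ k) $ n / fact k)"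
      by (simp add: sum.atLeast_Suc_atMost)
    finally have "complex_of_real (P $ n) =
        of_real ((if n = 1 then 1 else 0) + \<mu> * (\<Sum>k=1..n. (P ^ k) $ n / fact k))"
      by (simp add: fps_power_of_real_nth[OF FP] FP)
    then show ?thesis by (simp only: of_real_eq_iff)
  qed
  have "eventually (\<lambda>t. ereal (norm t) < fps_conv_radius F \<and> eval_fps F t = f t \<and> t \<in> S) (nhds 0)"
  proof (intro eventually_conj ev_S)
    have "eventually (\<lambda>t. t \<in> eball 0 (fps_conv_radius F)) (nhds (0::complex))"
      using F by (intro eventually_nhds_in_open) (auto simp: zero_ereal_def has_fps_expansion_def)
    then show "eventually (\<lambda>t. ereal (norm (t::complex)) < fps_conv_radius F) (nhds 0)"
      by simp
  qed (use F in \<open>simp add: has_fps_expansion_def\<close>)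
  then obtain r where r: "r > 0" "\<And>t :: complex. norm t < r \<Longrightarrow> ereal (norm t) < fps_conv_radius F"
    "\<And>t. norm t < r \<Longrightarrow> eval_fps F t = f t" "\<And>t. norm t < r \<Longrightarrow> t \<in> S"
    by (auto simp: eventually_nhds_metric)
  have lt: "?x * exp t < exp (-1)" if "\<bar>t\<bar> < r" for t
    using r(4)[of "of_real t"] that x assms by (simp add: S_def norm_mult abs_mult)
  show thesis
  proof (rule that[of r P])
    fix t :: real
    assume t: "\<bar>t\<bar> < r"
    define u where "u = Re (tree_fun (of_real (?x * exp t)))"
    have tree_u: "tree_fun (of_real ?x * exp (of_real t)) = of_real u"
      using tree_fun_of_real[of "?x * exp t"] lt[OF t] assms
      by (simp add: u_def abs_mult exp_of_real)
    have f_u: "f (of_real t) = of_real (t + u - \<mu>)"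
      by (simp only: f_def tree_u of_real_add of_real_diff)
    have "complex_of_real t \<in> S"
      using r(4) t by simp
    from exp_f[OF this] have "complex_of_real (\<mu> * exp (t + u - \<mu>)) = of_real u"
      unfolding f_u tree_u by (simp only: of_real_mult exp_of_real)
    then have "u / \<mu> = exp (t + u - \<mu>)"
      using assms by (simp only: of_real_eq_iff) (simp add: field_simps)
    then have f_t: "f (of_real t) = of_real (ln (u / \<mu>))"
      by (simp only: f_u ln_exp)
    have "(\<lambda>n. F $ n * of_real t ^ n) sums f (of_real t)"
      using sums_eval_fps[of "of_real t" F] r(2,3)[of "of_real t"] t by simp
    then have "(\<lambda>n. complex_of_real (P $ n * t ^ n)) sums of_real (ln (u / \<mu>))"
      by (simp add: FP f_t)
    then show "(\<lambda>n. P $ n * t ^ n) sums ln (Re (tree_fun (of_real (?x * exp t))) / \<mu>)"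
      by (simp only: sums_of_real_iff u_def)
  qed (fact r(1) P_eq lt | simp add: P_def F_0)+
qed

section \<open>The moment generating function\<close>

lemma borel_mgf:
  fixes X :: "'a \<Rightarrow> real"
  assumes \<mu>: "0 < \<mu>" "\<mu> < 1" and "prob_space M" and X: "X \<in> borel_measurable M"
    and mass: "\<And>n::nat. n \<ge> 1 \<Longrightarrow>
      measure M {\<omega> \<in> space M. X \<omega> = real n} =
        exp (- \<mu> * real n) * (\<mu> * real n) ^ (n - 1) / fact n"
    and t: "\<mu> * exp (- \<mu>) * exp t < exp (-1)"
  shows "integrable M (\<lambda>\<omega>. exp (t * X \<omega>))"
    and "(\<integral>\<omega>. exp (t * X \<omega>) \<partial>M) = Re (tree_fun (of_real (\<mu> * exp (- \<mu>) * exp t))) / \<mu>"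
proof -
  interpret prob_space M by fact
  let ?x = "\<mu> * exp (- \<mu>)"
  \<comment> \<open>The Borel mass at n is n^(n-1) / n! times \<open>?x ^ n / \<mu>\<close>, a term
    of the tree series. Taking \<open>s = 0\<close> gives total mass 1, taking \<open>s = t\<close>
    the moment generating function.\<close>
  have sums: "(\<lambda>n. exp (s * real (Suc n)) * prob {\<omega> \<in> space M. X \<omega> = real (Suc n)}) sums
      (Re (tree_fun (of_real (?x * exp s))) / \<mu>)" if "?x * exp s < exp (-1)" for s
  proof -
    have "(\<lambda>n. real (Suc n) ^ n / fact (Suc n) * (?x * exp s) ^ Suc n / \<mu>) sums
        (Re (tree_fun (of_real (?x * exp s))) / \<mu>)"
      using that \<mu> by (intro sums_divide Re_tree_fun_sums) (simp add: abs_mult)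
    moreover have "real (Suc n) ^ n / fact (Suc n) * (?x * exp s) ^ Suc n / \<mu> =
        exp (s * real (Suc n)) * prob {\<omega> \<in> space M. X \<omega> = real (Suc n)}" for n
    proof -
      have "(?x * exp s) ^ Suc n = \<mu> * \<mu> ^ n * exp (- \<mu> * real (Suc n)) * exp (s * real (Suc n))"
        by (simp only: power_mult_distrib power_Suc[of \<mu>] exp_of_nat_mult[symmetric])
           (simp only: mult_ac mult_minus_left)
      then show ?thesis
        using \<mu> mass[of "Suc n"]
        by (simp add: power_mult_distrib del: of_nat_Suc fact_Suc power_Suc)
    qed
    ultimately show ?thesis by simp
  qed
  have "(\<lambda>n. prob {\<omega> \<in> space M. X \<omega> = real (Suc n)}) sums 1"
    using sums[of 0] mult_exp_minus_lt[of \<mu>] \<mu> tree_fun_mult_exp_minus[OF \<mu>] by simp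
  note range = AE_range_of_sums_1[OF X this]
  have g: "(\<lambda>y. exp (t * y)) \<in> borel_measurable borel"
    by measurable
  have "summable (\<lambda>n. \<bar>exp (t * real (Suc n))\<bar> * prob {\<omega> \<in> space M. X \<omega> = real (Suc n)})"
    using sums[OF t] by (simp add: sums_iff)
  note expect = expectation_of_range[OF X range g this]
  show "integrable M (\<lambda>\<omega>. exp (t * X \<omega>))"
    by (rule expect(1))
  show "(\<integral>\<omega>. exp (t * X \<omega>) \<partial>M) = Re (tree_fun (of_real (?x * exp t))) / \<mu>"
    using sums_unique2[OF expect(2) sums[OF t]] .
qed

section \<open>The recursion for the cumulants\<close>

theorem proposition2p1:
  fixes M :: "'a measure" and X :: "'a \<Rightarrow> real" and \<mu> :: real
  assumes "0 < \<mu>" and "\<mu> < 1"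
    and "prob_space M" and "X \<in> borel_measurable M"
    and "\<And>n::nat. n \<ge> 1 \<Longrightarrow>
      measure M {\<omega> \<in> space M. X \<omega> = real n} =
        exp (- \<mu> * real n) * (\<mu> * real n) ^ (n - 1) / fact n"
  shows "has_cumulants M X (cumulant M X)
    \<and> cumulant M X 1 = 1 / (1 - \<mu>)
    \<and> (\<forall>n\<ge>2.
          cumulant M X n = \<mu> / (1 - \<mu>) * (complete_bell n (cumulant M X) - cumulant M X n)
        \<and> \<mu> / (1 - \<mu>) * (complete_bell n (cumulant M X) - cumulant M X n)
            = \<mu> / (1 - \<mu>) * (\<Sum>k=2..n. partial_bell n k (cumulant M X)))"
proof (rule borel_log_mgf_expansion[OF assms(1,2)])
  fix r and P :: "real fps"
  assume P: "r > 0" "P $ 0 = 0"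
    "\<And>n. P $ n = (if n = 1 then 1 else 0) + \<mu> * (\<Sum>k=1..n. (P ^ k) $ n / fact k)"
    "\<And>t. \<bar>t\<bar> < r \<Longrightarrow> \<mu> * exp (- \<mu>) * exp t < exp (-1)"
    "\<And>t. \<bar>t\<bar> < r \<Longrightarrow>
      (\<lambda>n. P $ n * t ^ n) sums ln (Re (tree_fun (of_real (\<mu> * exp (- \<mu>) * exp t))) / \<mu>)"
  have "has_cumulants M X (\<lambda>n. P $ n * fact n)"
    unfolding has_cumulants_def
  proof (intro exI[of _ r] conjI allI impI)
    fix t :: real
    assume t: "\<bar>t\<bar> < r"
    note mgf = borel_mgf[OF assms P(4)[OF t]]
    show "integrable M (\<lambda>\<omega>. exp (t * X \<omega>))"
      by (rule mgf(1))
    show "(\<lambda>n. P $ Suc n * fact (Suc n) * t ^ Suc n / fact (Suc n)) sums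
        ln (\<integral>\<omega>. exp (t * X \<omega>) \<partial>M)"
      using P(5)[OF t] sums_Suc_iff[of "\<lambda>n. P $ n * t ^ n"] P(2)
      by (simp add: mgf(2) del: fact_Suc power_Suc)
  qed (fact P(1))
  moreover from this have \<kappa>: "cumulant M X n = P $ n * fact n" if "n \<ge> 1" for n
    using that by (rule cumulant_eq)
  \<comment> \<open>\<open>has_cumulants\<close> reads a sequence from index 1 on, where the two
    sequences agree.\<close>
  ultimately have "has_cumulants M X (cumulant M X)"
    by (simp add: has_cumulants_def)
  have "P = Abs_fps (\<lambda>i. if i = 0 then 0 else cumulant M X i / fact i)"
    using P(2) by (auto simp: fps_eq_iff \<kappa>)
  then have bell: "partial_bell n k (cumulant M X) = fact n / fact k * (P ^ k) $ n" if "k \<ge> 1" for n k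
    using partial_bell_eq_fps_power[OF that] by simp
  \<comment> \<open>The equation for K at coefficient \<open>n\<close>, scaled by
    \<open>fact n\<close>.\<close>
  have rec: "cumulant M X n = (if n = 1 then 1 else 0) + \<mu> * complete_bell n (cumulant M X)"
    if "n \<ge> 1" for n
  proof -
    have "complete_bell n (cumulant M X) = fact n * (\<Sum>k=1..n. (P ^ k) $ n / fact k)"
      by (simp add: complete_bell_def bell sum_distrib_left)
    then show ?thesis
      using P(3)[of n] \<kappa>[OF that] by (simp add: algebra_simps)
  qed
  have split: "complete_bell n (cumulant M X) =
      cumulant M X n + (\<Sum>k=2..n. partial_bell n k (cumulant M X))" if "n \<ge> 1" for n
    using that partial_bell_1[OF that]
    by (simp add: complete_bell_def sum.atLeast_Suc_atMost numeral_2_eq_2)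
  \<comment> \<open>For \<open>n = 1\<close> the sum from \<open>k = 2\<close> is empty, so the
    first cumulant c satisfies c = 1 + \<mu> c.\<close>
  have "cumulant M X 1 = 1 / (1 - \<mu>)"
    using rec[of 1] split[of 1] assms(2) by (simp add: field_simps)
  \<comment> \<open>Here \<open>rec\<close> reads c = \<mu> B; subtract \<mu> c on both sides and
    divide by \<open>1 - \<mu>\<close>.\<close>
  moreover have "cumulant M X n = \<mu> / (1 - \<mu>) * (complete_bell n (cumulant M X) - cumulant M X n)"
    if "n \<ge> 2" for n
    using rec[of n] that assms(2) by (simp add: field_simps)
  ultimately show ?thesis
    using \<open>has_cumulants M X (cumulant M X)\<close> split by simp
qed

end
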